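(* For every positive integer $k$, $f_m(2,2,4k+1) = f_N(2,2,4k+1) + 1 = 4k+4$.
   Context: A product vector in $\mathbb{C}^{d_1}\otimes\cdots\otimes\mathbb{C}^{d_p}$ is a nonzero vector of the form $v_1\otimes\cdots\otimes v_p$ with $v_j\in\mathbb{C}^{d_j}$. An unextendible product basis (UPB) is a set $S$ of unit product vectors that are pairwise orthogonal and such that no product vector outside $S$ is orthogonal to every element of $S$. $f_m(d_1,\ldots,d_p)$ denotes the minimum cardinality of a UPB in $\mathbb{C}^{d_1}\otimes\cdots\otimes\mathbb{C}^{d_p}$, and $f_N(d_1,\ldots,d_p) := \sum_{j=1}^p (d_j - 1) + 1$. *)

theory Defs
  imports Complex_Main
begin

text \<open>The space C^{d_1} (x) ... (x) C^{d_p} is modelled by functions from index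
  lists (i_1,...,i_p), 0 <= i_j < d_j, to complex numbers (tensors w.r.t. the
  standard basis); entries outside the index set are required to be 0.
  The dimension vector (d_1,...,d_p) is the list dims.\<close>

definition tidx :: "nat list \<Rightarrow> nat list set" where
  "tidx dims = {is. length is = length dims \<and> (\<forall>j<length dims. is ! j < dims ! j)}"

definition tinner :: "nat list \<Rightarrow> (nat list \<Rightarrow> complex) \<Rightarrow> (nat list \<Rightarrow> complex) \<Rightarrow> complex" where
  "tinner dims T U = (\<Sum>is\<in>tidx dims. T is * cnj (U is))"

definition product_vector :: "nat list \<Rightarrow> (nat list \<Rightarrow> complex) \<Rightarrow> bool" where
  "product_vector dims T \<longleftrightarrow>
     (\<exists>vs :: (nat \<Rightarrow> complex) list. length vs = length dims \<and>
        (\<forall>is\<in>tidx dims. T is = (\<Prod>j<length dims. (vs ! j) (is ! j)))) \<and>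
     (\<forall>is. is \<notin> tidx dims \<longrightarrow> T is = 0) \<and>
     (\<exists>is\<in>tidx dims. T is \<noteq> 0)"

definition is_UPB :: "nat list \<Rightarrow> (nat list \<Rightarrow> complex) set \<Rightarrow> bool" where
  "is_UPB dims S \<longleftrightarrow>
     (\<forall>T\<in>S. product_vector dims T \<and> tinner dims T T = 1) \<and>
     (\<forall>T\<in>S. \<forall>U\<in>S. T \<noteq> U \<longrightarrow> tinner dims T U = 0) \<and>
     \<not> (\<exists>T. product_vector dims T \<and> T \<notin> S \<and> (\<forall>U\<in>S. tinner dims T U = 0))"

definition f_m :: "nat list \<Rightarrow> nat" where
  "f_m dims = (LEAST n. \<exists>S. finite S \<and> is_UPB dims S \<and> card S = n)"

definition f_N :: "nat list \<Rightarrow> nat" where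
  "f_N dims = (\<Sum>d\<leftarrow>dims. d - 1) + 1"

end

theory Submission
  imports Defs
begin

text \<open>Lower bound: a product vector orthogonal to a family exists as soon as the family splits into
  three parts, the j-th of which has a common orthogonal vector in the j-th factor. For a UPB with at
  most d + 2 elements in the space with factors of dimension 2, 2 and d, this forces the orthogonality
  graph of the first factor to be a perfect matching, so the size is even, and it forces the size
  to be d + 2. For d = 4k + 1 the number d + 2 is odd.

  Upper bound: put n = 2k + 2 and index 2n vectors by pairs (x, e) of x modulo n and a bit e. In the
  first factor use k + 1 different orthogonal bases, each vector being used twice, and in
  the second factor 2k + 2 different ones, each vector being used once. In the third factor, take
  vectors of dimension 2n - 3 given by a discrete Fourier construction: they are orthogonal whenever
  the first two factors are not, and the linear relations between them form a Vandermonde system, so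
  any 2n - 3 of them are a basis. A product vector is orthogonal to at most two of the vectors in the
  first factor and to at most one in the second factor, so it is not orthogonal to all of them.\<close>

subsection \<open>Product tensors\<close>

definition cin :: "nat \<Rightarrow> (nat \<Rightarrow> complex) \<Rightarrow> (nat \<Rightarrow> complex) \<Rightarrow> complex" where
  "cin d u v = (\<Sum>i<d. u i * cnj (v i))"

definition ptensor :: "nat list \<Rightarrow> (nat \<Rightarrow> complex) \<Rightarrow> (nat \<Rightarrow> complex) \<Rightarrow> (nat \<Rightarrow> complex)
    \<Rightarrow> nat list \<Rightarrow> complex" where
  "ptensor dims u v w = (\<lambda>is. if is \<in> tidx dims then u (is ! 0) * v (is ! 1) * w (is ! 2) else 0)"

abbreviation nonzero_vec :: "nat \<Rightarrow> (nat \<Rightarrow> complex) \<Rightarrow> bool" where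
  "nonzero_vec d u \<equiv> \<exists>i<d. u i \<noteq> 0"

lemma cin_cnj: "cnj (cin d u v) = cin d v u"
  by (simp add: cin_def mult.commute)

lemma cin_eq_0_commute: "cin d u v = 0 \<longleftrightarrow> cin d v u = 0"
  by (metis cin_cnj complex_cnj_zero_iff)

lemma cin_scale_left: "cin d (\<lambda>i. c * u i) v = c * cin d u v"
  by (simp add: cin_def sum_distrib_left mult.assoc)

lemma cin_scale_right: "cin d u (\<lambda>i. c * v i) = cnj c * cin d u v"
  by (simp add: cin_def sum_distrib_left mult.left_commute)

lemma cin_self: "cin d u u = of_real (\<Sum>i<d. (cmod (u i))\<^sup>2)"
  unfolding cin_def of_real_sum by (intro sum.cong refl) (metis complex_norm_square)

lemma cin_self_pos:
  assumes "nonzero_vec d u" shows "(\<Sum>i<d. (cmod (u i))\<^sup>2) > 0"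
proof -
  from assms obtain i where "i < d" "u i \<noteq> 0" by blast
  then show ?thesis by (intro sum_pos2[of _ i]) auto
qed

lemma tidx3: "tidx [a, b, c] = (\<lambda>(i, j, l). [i, j, l]) ` ({..<a} \<times> {..<b} \<times> {..<c})"
proof (intro equalityI subsetI)
  fix x assume "x \<in> tidx [a, b, c]"
  then have l: "length x = Suc (Suc (Suc 0))" and lt: "\<forall>j<3. x ! j < [a, b, c] ! j"
    by (auto simp: tidx_def numeral_3_eq_3)
  from l obtain i j l where x: "x = [i, j, l]" by (auto simp: length_Suc_conv)
  have "i < a" "j < b" "l < c"
    using lt[rule_format, of 0] lt[rule_format, of 1] lt[rule_format, of 2] by (simp_all add: x)
  then show "x \<in> (\<lambda>(i, j, l). [i, j, l]) ` ({..<a} \<times> {..<b} \<times> {..<c})"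
    using x by force
qed (auto simp: tidx_def less_Suc_eq numeral_2_eq_2)

lemma tinner_ptensor:
  "tinner [a, b, c] (ptensor [a, b, c] u v w) (ptensor [a, b, c] u' v' w')
     = cin a u u' * cin b v v' * cin c w w'"
proof -
  have inj: "inj_on (\<lambda>(i, j, l). [i, j, l]) ({..<a} \<times> {..<b} \<times> {..<c})"
    by (auto simp: inj_on_def)
  have "tinner [a, b, c] (ptensor [a, b, c] u v w) (ptensor [a, b, c] u' v' w')
      = (\<Sum>x\<in>tidx [a, b, c]. u (x ! 0) * v (x ! 1) * w (x ! 2)
            * cnj (u' (x ! 0) * v' (x ! 1) * w' (x ! 2)))"
    by (simp add: tinner_def ptensor_def)
  also have "\<dots> = (\<Sum>(i, j, l)\<in>{..<a} \<times> {..<b} \<times> {..<c}.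
        (u i * cnj (u' i)) * ((v j * cnj (v' j)) * (w l * cnj (w' l))))"
    unfolding tidx3 by (subst sum.reindex[OF inj]) (auto intro!: sum.cong)
  also have "\<dots> = (\<Sum>i<a. \<Sum>j<b. \<Sum>l<c.
        (u i * cnj (u' i)) * ((v j * cnj (v' j)) * (w l * cnj (w' l))))"
    by (simp add: sum.cartesian_product)
  also have "\<dots> = cin a u u' * (cin b v v' * cin c w w')"
    by (simp only: cin_def sum_distrib_left[symmetric] sum_distrib_right[symmetric])
  finally show ?thesis by (simp add: mult.assoc)
qed

lemma product_vector_iff:
  "product_vector [a, b, c] T \<longleftrightarrow>
     (\<exists>u v w. T = ptensor [a, b, c] u v w \<and> nonzero_vec a u \<and> nonzero_vec b v \<and> nonzero_vec c w)"
proof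
  assume "product_vector [a, b, c] T"
  then obtain vs where
    eq: "\<forall>x\<in>tidx [a, b, c]. T x = (\<Prod>j<length [a, b, c]. (vs ! j) (x ! j))"
    and out: "\<forall>x. x \<notin> tidx [a, b, c] \<longrightarrow> T x = 0"
    and nz: "\<exists>x\<in>tidx [a, b, c]. T x \<noteq> 0"
    unfolding product_vector_def by blast
  have T: "T = ptensor [a, b, c] (vs ! 0) (vs ! 1) (vs ! 2)"
    using eq out by (auto simp: ptensor_def fun_eq_iff numeral_2_eq_2)
  moreover obtain i j l where "i < a" "j < b" "l < c" "T [i, j, l] \<noteq> 0"
    using nz unfolding tidx3 by auto
  moreover from this T have "(vs ! 0) i \<noteq> 0" "(vs ! 1) j \<noteq> 0" "(vs ! 2) l \<noteq> 0"
    by (auto simp: ptensor_def split: if_splits)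
  ultimately show "\<exists>u v w. T = ptensor [a, b, c] u v w \<and> nonzero_vec a u \<and> nonzero_vec b v
      \<and> nonzero_vec c w"
    by blast
next
  assume "\<exists>u v w. T = ptensor [a, b, c] u v w \<and> nonzero_vec a u \<and> nonzero_vec b v
      \<and> nonzero_vec c w"
  then obtain u v w i j l where T: "T = ptensor [a, b, c] u v w"
    and ijl: "i < a" "u i \<noteq> 0" "j < b" "v j \<noteq> 0" "l < c" "w l \<noteq> 0" by blast
  have mem: "[i, j, l] \<in> tidx [a, b, c]" using ijl unfolding tidx3 by force
  show "product_vector [a, b, c] T"
    unfolding product_vector_def
  proof (intro conjI)
    show "\<exists>vs. length vs = length [a, b, c] \<and>
        (\<forall>is\<in>tidx [a, b, c]. T is = (\<Prod>j<length [a, b, c]. (vs ! j) (is ! j)))"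
      by (rule exI[of _ "[u, v, w]"]) (simp add: T ptensor_def numeral_2_eq_2)
    show "\<exists>is\<in>tidx [a, b, c]. T is \<noteq> 0"
      using mem ijl by (intro bexI[of _ "[i, j, l]"]) (auto simp: T ptensor_def)
  qed (simp add: T ptensor_def)
qed

text \<open>Rescaling only the first factor by the inverse norm of the whole tensor gives unit
  vectors. Different indices give different tensors, since otherwise one inner product would be both
  1 and 0. \<open>unext\<close> rules out every product vector orthogonal to the family, in
  particular those outside it.\<close>

lemma UPB_of_family:
  fixes u v w :: "'i \<Rightarrow> nat \<Rightarrow> complex"
  assumes "finite I"
    and nz: "\<And>i. i \<in> I \<Longrightarrow> nonzero_vec a (u i) \<and> nonzero_vec b (v i) \<and> nonzero_vec c (w i)"
    and orth: "\<And>i j. \<lbrakk>i \<in> I; j \<in> I; i \<noteq> j\<rbrakk> \<Longrightarrow>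
      cin a (u i) (u j) = 0 \<or> cin b (v i) (v j) = 0 \<or> cin c (w i) (w j) = 0"
    and unext: "\<And>x y z. \<lbrakk>nonzero_vec a x; nonzero_vec b y; nonzero_vec c z\<rbrakk> \<Longrightarrow>
      \<exists>i\<in>I. cin a x (u i) \<noteq> 0 \<and> cin b y (v i) \<noteq> 0 \<and> cin c z (w i) \<noteq> 0"
  shows "\<exists>S. finite S \<and> is_UPB [a, b, c] S \<and> card S = card I"
proof -
  define r where "r i = (\<Sum>l<a. (cmod (u i l))\<^sup>2) * (\<Sum>l<b. (cmod (v i l))\<^sup>2)
    * (\<Sum>l<c. (cmod (w i l))\<^sup>2)" for i
  define s where "s i = complex_of_real (1 / sqrt (r i))" for i
  define P where "P i = ptensor [a, b, c] (\<lambda>l. s i * u i l) (v i) (w i)" for i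
  have r: "r i > 0" if "i \<in> I" for i
    unfolding r_def using nz[OF that] by (intro mult_pos_pos cin_self_pos) auto
  then have s: "s i \<noteq> 0" if "i \<in> I" for i
    using that by (force simp: s_def)
  have inner: "tinner [a, b, c] (P i) (P j) = s i * cnj (s j)
      * (cin a (u i) (u j) * cin b (v i) (v j) * cin c (w i) (w j))" for i j
    by (simp add: P_def tinner_ptensor cin_scale_left cin_scale_right)
  have unit: "tinner [a, b, c] (P i) (P i) = 1" if "i \<in> I" for i
  proof -
    have "tinner [a, b, c] (P i) (P i) = of_real ((1 / sqrt (r i)) * (1 / sqrt (r i)) * r i)"
      unfolding inner cin_self r_def s_def by (simp only: of_real_mult complex_cnj_complex_of_real)
    also have "(1 / sqrt (r i)) * (1 / sqrt (r i)) * r i = 1"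
      using r[OF that] by (simp add: real_div_sqrt field_simps)
    finally show ?thesis by simp
  qed
  have orthP: "tinner [a, b, c] (P i) (P j) = 0" if "i \<in> I" "j \<in> I" "i \<noteq> j" for i j
    using orth[OF that] by (auto simp: inner)
  have injP: "inj_on P I"
    using unit orthP by (metis inj_onI zero_neq_one)
  have pv: "product_vector [a, b, c] (P i)" if "i \<in> I" for i
    unfolding product_vector_iff P_def
    using nz[OF that] s[OF that]
    by (intro exI[of _ "\<lambda>l. s i * u i l"] exI[of _ "v i"] exI[of _ "w i"]) auto
  have "\<exists>U\<in>P ` I. tinner [a, b, c] T U \<noteq> 0" if T: "product_vector [a, b, c] T" for T
  proof -
    obtain x y z where xyz: "T = ptensor [a, b, c] x y z" "nonzero_vec a x" "nonzero_vec b y"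
        "nonzero_vec c z"
      using T unfolding product_vector_iff by blast
    obtain i where "i \<in> I" "cin a x (u i) \<noteq> 0" "cin b y (v i) \<noteq> 0" "cin c z (w i) \<noteq> 0"
      using unext[OF xyz(2-4)] by blast
    then show ?thesis
      using s[of i] by (intro bexI[of _ "P i"]) (auto simp: xyz P_def tinner_ptensor cin_scale_right)
  qed
  then have "is_UPB [a, b, c] (P ` I)"
    unfolding is_UPB_def using pv unit orthP by (auto, metis)
  then show ?thesis
    using \<open>finite I\<close> injP by (intro exI[of _ "P ` I"]) (auto simp: card_image)
qed

subsection \<open>Lower bound\<close>

text \<open>Induction on the equations: two independent solutions of the old equations are combined
  so that the new one holds as well.\<close>

lemma homogeneous_system_solvable:
  fixes g :: "'b \<Rightarrow> 'i \<Rightarrow> 'a::field"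
  assumes "finite C" "finite I" "card C < card I"
  shows "\<exists>c. (\<exists>i\<in>I. c i \<noteq> 0) \<and> (\<forall>U\<in>C. (\<Sum>i\<in>I. c i * g U i) = 0)"
  using assms
proof (induction C arbitrary: I rule: finite_induct)
  case empty
  then show ?case by (intro exI[of _ "\<lambda>_. 1"]) (auto simp: card_gt_0_iff)
next
  case (insert V C)
  let ?s = "\<lambda>c I. \<Sum>i\<in>I. c i * g V i"
  obtain c where c: "\<exists>i\<in>I. c i \<noteq> 0" "\<forall>U\<in>C. (\<Sum>i\<in>I. c i * g U i) = 0"
    using insert.IH[of I] insert.prems insert.hyps by auto
  obtain i0 where i0: "i0 \<in> I" "c i0 \<noteq> 0" using c by blast
  \<comment> \<open>A solution supported away from \<open>i0\<close> is independent of
    \<open>c\<close>, because \<open>c i0\<close> is nonzero.\<close>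
  let ?J = "I - {i0}"
  have "card C < card ?J" using insert i0 by simp
  then obtain c' where c': "\<exists>i\<in>?J. c' i \<noteq> 0" "\<forall>U\<in>C. (\<Sum>i\<in>?J. c' i * g U i) = 0"
    using insert.IH[of ?J] insert.prems by auto
  define e where "e i = (if i = i0 then 0 else c' i)" for i
  have e: "(\<Sum>i\<in>I. e i * h i) = (\<Sum>i\<in>?J. c' i * h i)" for h
    using i0 \<open>finite I\<close> by (simp add: sum.remove[of I i0] e_def)
  define p q where "p = ?s c I" and "q = ?s e I"
  define b where "b i = e i * p - c i * q" for i
  have lin: "(\<Sum>i\<in>I. b i * h i) = p * (\<Sum>i\<in>I. e i * h i) - q * (\<Sum>i\<in>I. c i * h i)" for h
    by (simp add: b_def sum_distrib_left sum_subtractf algebra_simps)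
  have sol: "(\<Sum>i\<in>I. b i * g U i) = 0" if "U \<in> insert V C" for U
  proof (cases "U = V")
    case True
    then show ?thesis by (simp add: lin p_def q_def)
  next
    case False
    then show ?thesis using that c(2) c'(2) by (simp add: lin e)
  qed
  show ?case
  proof (cases "p = 0")
    case True
    then show ?thesis using c by (intro exI[of _ c]) (auto simp: p_def)
  next
    case False
    have "\<exists>i\<in>I. b i \<noteq> 0"
    proof (cases "q = 0")
      case True
      then show ?thesis using c'(1) False by (auto simp: b_def e_def)
    next
      case False
      then show ?thesis using i0 by (intro bexI[of _ i0]) (auto simp: b_def e_def)
    qed
    then show ?thesis using sol by blast
  qed
qed

lemma orthogonal_vector_exists:
  assumes "finite C" "card C < d"
  shows "\<exists>x. nonzero_vec d x \<and> (\<forall>U\<in>C. cin d x (w U) = 0)"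
  using homogeneous_system_solvable[of C "{..<d}" "\<lambda>U i. cnj (w U i)"] assms
  by (auto simp: cin_def)

text \<open>A matched pair is removed. By uniqueness and symmetry neither of its members is the
  partner of a remaining element, so the matching restricts to the rest.\<close>

lemma even_card_of_matching:
  assumes "finite S"
    and "\<And>x. x \<in> S \<Longrightarrow> \<exists>!y. y \<in> S \<and> R x y"
    and "\<And>x y. R x y \<Longrightarrow> R y x" and "\<And>x. \<not> R x x"
  shows "even (card S)"
  using assms
proof (induction "card S" arbitrary: S rule: less_induct)
  case less
  show ?case
  proof (cases "S = {}")
    case False
    then obtain x where x: "x \<in> S" by blast
    obtain y where y: "y \<in> S" "R x y" using less.prems(2)[OF x] by blast
    have neq: "x \<noteq> y" using y less.prems(4) by blast
    let ?S = "S - {x, y}"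
    have card: "card S = Suc (Suc (card ?S))"
      using x y neq \<open>finite S\<close>
      by (metis Diff_insert2 card_Suc_Diff1 finite_Diff insertE insert_Diff)
    have "\<exists>!b. b \<in> ?S \<and> R a b" if a: "a \<in> ?S" for a
    proof -
      obtain b where b: "b \<in> S" "R a b" using less.prems(2)[of a] a by blast
      have "\<not> R a x"
      proof
        assume "R a x"
        then have "a = y" using less.prems(2)[OF x] less.prems(3) y a by blast
        then show False using a by blast
      qed
      moreover have "\<not> R a y"
      proof
        assume "R a y"
        then have "a = x" using less.prems(2)[OF y(1)] less.prems(3) x y(2) a by blast
        then show False using a by blast
      qed
      ultimately have "b \<in> ?S" using b by blast
      then show ?thesis using b less.prems(2)[of a] a by blast
    qed
    then have "even (card ?S)"
      using less.hyps[of ?S] card less.prems by auto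
    then show ?thesis using card by simp
  qed simp
qed

lemma UPB_card_lower:
  assumes "finite S" "is_UPB [2, 2, d] S" "d > 0" "card S \<le> d + 2"
  shows "card S = d + 2 \<and> even (card S)"
proof -
  define Q where "Q T p \<longleftrightarrow> T = ptensor [2, 2, d] (fst p) (fst (snd p)) (snd (snd p)) \<and>
      nonzero_vec 2 (fst p) \<and> nonzero_vec 2 (fst (snd p)) \<and> nonzero_vec d (snd (snd p))" for T p
  have ex: "\<exists>p. Q T p" if T: "T \<in> S" for T
  proof -
    have "product_vector [2, 2, d] T" using assms(2) T unfolding is_UPB_def by simp
    then obtain u v w where "T = ptensor [2, 2, d] u v w" "nonzero_vec 2 u" "nonzero_vec 2 v"
        "nonzero_vec d w"
      unfolding product_vector_iff by blast
    then show ?thesis unfolding Q_def by (intro exI[of _ "(u, v, w)"]) simp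
  qed
  define F where "F T = (SOME p. Q T p)" for T
  define u v w where "u T = fst (F T)" and "v T = fst (snd (F T))" and "w T = snd (snd (F T))" for T
  have Q: "Q T (F T)" if "T \<in> S" for T
    unfolding F_def using ex[OF that] by (rule someI_ex)
  have T: "T = ptensor [2, 2, d] (u T) (v T) (w T)"
    and nz: "nonzero_vec 2 (u T)" "nonzero_vec 2 (v T)" "nonzero_vec d (w T)" if "T \<in> S" for T
    using Q[OF that] unfolding Q_def u_def v_def w_def by simp_all
  have inner: "tinner [2, 2, d] (ptensor [2, 2, d] x y z) U = cin 2 x (u U) * cin 2 y (v U) * cin d z (w U)"
    if "U \<in> S" for x y z U
    by (subst T[OF that]) (rule tinner_ptensor)
  have orth: "cin 2 (u X) (u U) = 0 \<or> cin 2 (v X) (v U) = 0 \<or> cin d (w X) (w U) = 0"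
    if "X \<in> S" "U \<in> S" "X \<noteq> U" for X U
  proof -
    have "tinner [2, 2, d] X U = 0" using assms(2) that unfolding is_UPB_def by simp
    then show ?thesis using inner[OF that(2), of "u X" "v X" "w X"] T[OF that(1)] by simp
  qed
  have unext: "\<exists>U\<in>S. cin 2 x (u U) \<noteq> 0 \<and> cin 2 y (v U) \<noteq> 0 \<and> cin d z (w U) \<noteq> 0"
    if "nonzero_vec 2 x" "nonzero_vec 2 y" "nonzero_vec d z" for x y z
  proof (rule ccontr)
    let ?X = "ptensor [2, 2, d] x y z"
    assume "\<not> ?thesis"
    then have "\<forall>U\<in>S. tinner [2, 2, d] ?X U = 0" using inner by auto
    moreover have "product_vector [2, 2, d] ?X" unfolding product_vector_iff using that by blast
    \<comment> \<open>\<open>is_UPB\<close> excludes only product vectors outside \<open>S\<close>;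
      what remains is a member orthogonal to itself, which contradicts its unit norm.\<close>
    ultimately have "?X \<in> S" "tinner [2, 2, d] ?X ?X = 0"
      using assms(2) unfolding is_UPB_def by auto
    then show False using assms(2) unfolding is_UPB_def by force
  qed
  have perp: "\<exists>x. nonzero_vec 2 x \<and> cin 2 x f = 0" for f
    using orthogonal_vector_exists[of "{()}" 2 "\<lambda>_. f"] by auto
  \<comment> \<open>Each two-dimensional factor can take care of one member. If fewer than
    \<open>d\<close> others remained, they would have a common orthogonal vector in the third
    factor.\<close>
  have count: "\<not> card (S - {X, Y}) < d" for X Y
  proof
    assume "card (S - {X, Y}) < d"
    then obtain z where "nonzero_vec d z" "\<forall>U\<in>S - {X, Y}. cin d z (w U) = 0"
      using orthogonal_vector_exists[of "S - {X, Y}" d w] \<open>finite S\<close> by auto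
    moreover obtain x y where "nonzero_vec 2 x" "cin 2 x (u X) = 0" "nonzero_vec 2 y" "cin 2 y (v Y) = 0"
      using perp[of "u X"] perp[of "v Y"] by blast
    ultimately show False using unext[of x y z] by blast
  qed
  \<comment> \<open>The bound \<open>d + 2\<close> enters here: without three members at most
    \<open>d - 1\<close> are left.\<close>
  have triple: "card (S - {X, Y, Z}) < d" if "X \<in> S" "Y \<in> S" "Z \<in> S" "X \<noteq> Y" "Z \<notin> {X, Y}" for X Y Z
  proof -
    have "card {X, Y, Z} = 3" using that by (auto simp: card_insert_if)
    moreover have "card (S - {X, Y, Z}) = card S - card {X, Y, Z}"
      using that by (intro card_Diff_subset) auto
    ultimately show ?thesis using \<open>d > 0\<close> assms(4) by linarith
  qed
  have rest: "\<exists>Z z. nonzero_vec d z \<and> (\<forall>U\<in>S - {X, Y, Z}. cin d z (w U) = 0)"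
    if XY: "X \<in> S" "Y \<in> S" "X \<noteq> Y" for X Y
  proof -
    have "S - {X, Y} \<noteq> {}" using count[of X Y] \<open>d > 0\<close> by (metis card.empty)
    then obtain Z where Z: "Z \<in> S" "Z \<notin> {X, Y}" by blast
    then show ?thesis
      using orthogonal_vector_exists[of "S - {X, Y, Z}" d w] triple[OF XY(1,2) Z(1) XY(3) Z(2)]
        \<open>finite S\<close> by blast
  qed
  \<comment> \<open>If \<open>x\<close> were orthogonal to two members in the first factor, the
    second factor could take care of a third one and the third factor of all others.\<close>
  have party1_unique: "X = Y" if XY: "X \<in> S" "Y \<in> S" "nonzero_vec 2 x" "cin 2 x (u X) = 0" "cin 2 x (u Y) = 0"
    for X Y x
  proof (rule ccontr)
    assume "X \<noteq> Y"
    then obtain Z z where "nonzero_vec d z" "\<forall>U\<in>S - {X, Y, Z}. cin d z (w U) = 0"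
      using rest[OF XY(1,2)] by auto
    moreover obtain y where "nonzero_vec 2 y" "cin 2 y (v Z) = 0" using perp[of "v Z"] by blast
    ultimately show False using unext[of x y z] XY by blast
  qed
  have party2_unique: "X = Y" if XY: "X \<in> S" "Y \<in> S" "nonzero_vec 2 x" "cin 2 x (v X) = 0" "cin 2 x (v Y) = 0"
    for X Y x
  proof (rule ccontr)
    assume "X \<noteq> Y"
    then obtain Z z where "nonzero_vec d z" "\<forall>U\<in>S - {X, Y, Z}. cin d z (w U) = 0"
      using rest[OF XY(1,2)] by auto
    moreover obtain y where "nonzero_vec 2 y" "cin 2 y (u Z) = 0" using perp[of "u Z"] by blast
    ultimately show False using unext[of y x z] XY by blast
  qed
  define R where "R X Y \<longleftrightarrow> X \<noteq> Y \<and> cin 2 (u X) (u Y) = 0" for X Y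
  have "\<exists>!Y. Y \<in> S \<and> R X Y" if X: "X \<in> S" for X
  proof -
    have "\<exists>Y. Y \<in> S \<and> R X Y"
    proof (rule ccontr)
      assume no: "\<not> ?thesis"
      \<comment> \<open>Without a neighbour of \<open>X\<close> in the first factor, and with at
        most one in the second, \<open>w X\<close> is itself orthogonal to all \<open>w U\<close>
        other than those of \<open>X\<close> and \<open>Y\<close>. These two are handled by the
        first and the second factor.\<close>
      obtain Y where Y: "\<forall>U\<in>S. cin 2 (v X) (v U) = 0 \<longrightarrow> U = Y"
        using party2_unique[OF _ _ nz(2)[OF X]] by blast
      obtain x y where "nonzero_vec 2 x" "cin 2 x (u X) = 0" "nonzero_vec 2 y" "cin 2 y (v Y) = 0"
        using perp[of "u X"] perp[of "v Y"] by blast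
      moreover have "cin d (w X) (w U) = 0" if "U \<in> S" "U \<noteq> X" "U \<noteq> Y" for U
        using orth[OF X that(1)] that no Y unfolding R_def by blast
      ultimately show False using unext[of x y "w X"] nz(3)[OF X] by blast
    qed
    moreover have "Y = Z" if "Y \<in> S \<and> R X Y" "Z \<in> S \<and> R X Z" for Y Z
      using party1_unique[of Y Z "u X"] nz(1)[OF X] that unfolding R_def by blast
    ultimately show ?thesis by blast
  qed
  moreover have "R Y X" if "R X Y" for X Y
    using that cin_eq_0_commute unfolding R_def by metis
  moreover have "\<not> R X X" for X by (simp add: R_def)
  ultimately have even: "even (card S)"
    using even_card_of_matching[of S R] \<open>finite S\<close> by blast
  moreover have "card S = d + 2"
  proof (rule ccontr)
    assume "card S \<noteq> d + 2"
    then have le: "card S \<le> d + 1" using assms(4) by simp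
    \<comment> \<open>Two distinct members are needed: removing them leaves at most
      \<open>d - 1\<close>, against \<open>count\<close>.\<close>
    have "2 \<le> card S"
    proof -
      have "S \<noteq> {}" using count[of undefined undefined] \<open>d > 0\<close> by force
      then show ?thesis using even \<open>finite S\<close>
        by (metis card_gt_0_iff dvd_imp_le)
    qed
    then obtain X Y where "X \<in> S" "Y \<in> S" "X \<noteq> Y"
      by (metis card_le_Suc0_iff_eq \<open>finite S\<close> not_less_eq_eq numeral_2_eq_2)
    then have "card (S - {X, Y}) = card S - 2" by (simp add: card_Diff_subset)
    then show False using count[of X Y] le \<open>d > 0\<close> by linarith
  qed
  ultimately show ?thesis by blast
qed

subsection \<open>Construction of the product basis\<close>

definition planar :: "nat \<Rightarrow> bool \<Rightarrow> nat \<Rightarrow> complex" where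
  "planar t e i = (if e then (if i = 0 then - of_nat t else 1) else (if i = 0 then 1 else of_nat t))"

lemma planar_nonzero: "nonzero_vec 2 (planar t e)"
  by (cases e) (auto simp: planar_def intro: exI[of _ 1] exI[of _ 0])

lemma cin_planar:
  "cin 2 x (planar t e) = (if e then x 1 - of_nat t * x 0 else x 0 + of_nat t * x 1)"
  by (simp add: cin_def planar_def numeral_2_eq_2 mult.commute)

lemma planar_orthogonal: "e \<noteq> e' \<Longrightarrow> cin 2 (planar t e) (planar t e') = 0"
  by (auto simp: cin_planar) (simp_all add: planar_def)

text \<open>In the plane two vectors orthogonal to the same nonzero vector are parallel. In the
  mixed case (1, a) and (-b, 1) would need 1 + a * b = 0, which is impossible for natural
  numbers.\<close>

lemma planar_eqI:
  assumes "nonzero_vec 2 x" "cin 2 x (planar s e) = 0" "cin 2 x (planar t e') = 0"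
  shows "s = t \<and> e = e'"
proof -
  have nz: "x 0 \<noteq> 0 \<or> x 1 \<noteq> 0" using assms(1) by (auto simp: less_2_cases_iff)
  have mixed: False if "x 0 + of_nat a * x 1 = 0" "x 1 - of_nat b * x 0 = 0" for a b
  proof -
    have x1: "x 1 = of_nat b * x 0" using that by simp
    then have "of_nat (1 + a * b) * x 0 = 0" using that(1) by (simp add: algebra_simps)
    then have "x 0 = 0" by (simp only: mult_eq_0_iff of_nat_eq_0_iff) simp
    then show False using x1 nz by simp
  qed
  show ?thesis
  proof (cases e; cases e')
    assume e: "e" "e'"
    then have "x 1 = of_nat s * x 0" "x 1 = of_nat t * x 0" using assms by (simp_all add: cin_planar)
    moreover from this nz have "x 0 \<noteq> 0" by auto
    ultimately show ?thesis using e by simp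
  next
    assume e: "\<not> e" "\<not> e'"
    then have "x 0 + of_nat s * x 1 = 0" "x 0 + of_nat t * x 1 = 0"
      using assms by (simp_all add: cin_planar)
    moreover from this nz have "x 1 \<noteq> 0" by auto
    ultimately show ?thesis using e by (metis add_left_cancel mult_right_cancel of_nat_eq_iff)
  qed (use assms mixed in \<open>auto simp: cin_planar\<close>)
qed

lemma cis_root_power_eq:
  fixes n a b :: nat
  assumes "n > 0" "cis (2 * pi / n) ^ a = cis (2 * pi / n) ^ b"
  shows "a mod n = b mod n"
proof -
  let ?z = "cis (2 * pi / n)"
  have one: "?z ^ n = 1" using assms(1) by (simp add: DeMoivre)
  have red: "?z ^ j = cis (2 * pi * real (j mod n) / real n)" for j
  proof -
    have "?z ^ j = ?z ^ (n * (j div n) + j mod n)" by simp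
    also have "\<dots> = ?z ^ (j mod n)" by (simp only: power_add power_mult one) simp
    finally show ?thesis by (simp add: DeMoivre mult_ac)
  qed
  have "inj_on (\<lambda>k. cis (2 * pi * real k / real n)) {..<n}"
    using bij_betw_roots_unity[OF assms(1)] by (rule bij_betw_imp_inj_on)
  then show ?thesis using assms red[of a] red[of b] by (auto simp: inj_on_def)
qed

lemma sum_powers_root_unity:
  fixes z :: complex
  assumes "z ^ n = 1" "z \<noteq> 1"
  shows "(\<Sum>i<n. z ^ i) = 0"
  using assms by (simp add: geometric_sum)

text \<open>To isolate the value at \<open>t\<close>, the relations are combined into a Laurent
  polynomial in \<open>l\<close> that vanishes at the other two points of the support.\<close>

lemma vandermonde3:
  fixes g l :: "'i \<Rightarrow> 'a::field"
  assumes "finite V" "T \<subseteq> V" "card T \<le> 3" "inj_on l V" "\<And>i. i \<in> V \<Longrightarrow> l i \<noteq> 0"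
    and supp: "\<And>i. i \<in> V - T \<Longrightarrow> g i = 0"
    and eqs: "(\<Sum>i\<in>V. g i) = 0" "(\<Sum>i\<in>V. g i * l i) = 0" "(\<Sum>i\<in>V. g i * inverse (l i)) = 0"
    and "t \<in> V"
  shows "g t = 0"
proof (cases "t \<in> T")
  case True
  have fT: "finite T" using assms finite_subset by blast
  have "card (T - {t}) \<le> 2" using True fT assms(3) by simp
  \<comment> \<open>The case \<open>a = b\<close> covers supports with fewer than three points. For
    \<open>T = {t}\<close> there is no other point, and the first relation alone will do.\<close>
  then obtain a b where ab: "T - {t} \<subseteq> {a, b}" "{a, b} \<subseteq> V" "t \<notin> {a, b} \<or> T = {t}"
  proof -
    consider "card (T - {t}) = 0" | "card (T - {t}) = 1" | "card (T - {t}) = 2"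
      using \<open>card (T - {t}) \<le> 2\<close> by linarith
    then show ?thesis
    proof cases
      case 1
      then have "T - {t} = {}" using fT by (metis card_0_eq finite_Diff)
      then have "T = {t}" using True by blast
      then show ?thesis using that[of t t] \<open>t \<in> V\<close> by auto
    next
      case 2
      then obtain a where "T - {t} = {a}" by (auto simp: card_1_singleton_iff)
      then show ?thesis using that[of a a] assms(2) by auto
    next
      case 3
      then obtain a b where "T - {t} = {a, b}" by (auto simp: card_2_iff)
      then show ?thesis using that[of a b] assms(2) by auto
    qed
  qed
  show ?thesis
  proof (cases "T = {t}")
    case True
    then have "(\<Sum>i\<in>V. g i) = g t"
      using supp \<open>t \<in> V\<close> \<open>finite V\<close> by (subst sum.mono_neutral_right[of V "{t}"]) auto
    then show ?thesis using eqs by simp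
  next
    case False
    \<comment> \<open>With L for \<open>l i\<close>, (L - l a) * (L - l b) / L = L - (l a + l b) + l
      a * l b / L uses exactly the three given relations.\<close>
    let ?h = "\<lambda>i. g i * ((l i - l a) * (l i - l b) * inverse (l i))"
    have "(\<Sum>i\<in>V. ?h i) = (\<Sum>i\<in>V. g i * l i - (l a + l b) * g i + l a * l b * (g i * inverse (l i)))"
      using assms(5) by (intro sum.cong) (auto simp: field_simps)
    also have "\<dots> = 0"
      by (simp add: sum.distrib sum_subtractf sum_distrib_left[symmetric] eqs)
    finally have "(\<Sum>i\<in>V. ?h i) = 0" .
    moreover have "(\<Sum>i\<in>V. ?h i) = ?h t"
      using supp \<open>t \<in> V\<close> \<open>finite V\<close> ab(1) by (subst sum.mono_neutral_right[of V "{t}"]) auto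
    ultimately have "?h t = 0" by simp
    moreover have "l t \<noteq> l a" "l t \<noteq> l b" "l t \<noteq> 0"
      using ab False \<open>inj_on l V\<close> \<open>t \<in> V\<close> assms(5) by (auto simp: inj_on_def)
    ultimately show ?thesis by simp
  qed
qed (use supp \<open>t \<in> V\<close> in blast)

section \<open>The Fourier family and the frequencies with singular Gram block\<close>

locale fourier_family =
  fixes m :: nat
  assumes m: "m \<ge> 2"
begin

text \<open>The Gram matrix of the vectors \<open>w v\<close> is block diagonal in the Fourier basis, with block
  \<open>((1, z f), (cnj (z f), 1))\<close> at frequency \<open>f\<close>. Since \<open>z\<close> is a combination of three characters,
  \<open>w (x, False)\<close> and \<open>w (y, True)\<close> can fail to be orthogonal only if \<open>x = y\<close> or \<open>x = y + 1\<close> modulo \<open>m\<close>.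
  The value of \<open>p\<close> makes \<open>z 1 = \<zeta>\<close>, so that \<open>\<bar>z f\<bar> = 1\<close> exactly for \<open>f\<close> in \<open>{0, 1, n - 1}\<close>.
  The coordinates \<open>i < n\<close> of \<open>w v\<close> belong to frequency \<open>i\<close>, the coordinates \<open>i \<ge> n\<close> to frequency
  \<open>i - n + 2\<close> in \<open>{2..n - 2}\<close>.\<close>

definition n :: nat where "n = 2 * m"
definition \<zeta> :: complex where "\<zeta> = cis (pi / n)"
definition \<omega> :: complex where "\<omega> = cis (2 * pi / n)"
definition p :: real where "p = 1 / (2 * cos (pi / n))"
definition c :: "nat \<Rightarrow> real" where "c f = (if even f then 1 - p else p)"
definition z :: "nat \<Rightarrow> complex" where "z f = of_real p + of_real (c f) * \<omega> ^ f"
definition s :: "nat \<Rightarrow> complex" where "s f = of_real (sqrt (1 - (cmod (z f))\<^sup>2))"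
definition w :: "nat \<times> bool \<Rightarrow> nat \<Rightarrow> complex" where
  "w v i = (let x = fst v in
     if i < n then (\<omega> ^ x) ^ i * (if snd v then z i else 1)
     else if snd v then (\<omega> ^ x) ^ (i - n + 2) * s (i - n + 2) else 0)"
definition V :: "(nat \<times> bool) set" where "V = {..<n} \<times> UNIV"

lemma n_ge: "n \<ge> 4" "n > 0" and even_n: "even n"
  using m by (auto simp: n_def)

lemma \<omega>_eq: "\<omega> = \<zeta>\<^sup>2"
  by (simp add: \<omega>_def \<zeta>_def DeMoivre)

lemma \<zeta>_power_n: "\<zeta> ^ n = -1"
  using n_ge by (simp add: \<zeta>_def DeMoivre)

lemma \<omega>_power_n: "\<omega> ^ n = 1"
  using n_ge by (simp add: \<omega>_def DeMoivre)

lemma unimodular: "\<omega> * cnj \<omega> = 1" "\<zeta> * cnj \<zeta> = 1"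
  by (simp_all add: \<omega>_def \<zeta>_def cis_cnj cis_mult)

lemma unimodular_power: "\<omega> ^ j * cnj \<omega> ^ j = 1"
  by (metis unimodular(1) power_mult_distrib power_one)

lemma roots_nonzero: "\<omega> ^ j \<noteq> 0" "\<zeta> \<noteq> 0"
  by (simp_all add: \<omega>_def \<zeta>_def)

lemma \<omega>_power_inj: "\<lbrakk>x < n; y < n; \<omega> ^ x = \<omega> ^ y\<rbrakk> \<Longrightarrow> x = y"
  using cis_root_power_eq[of n x y] n_ge by (simp add: \<omega>_def)

lemma \<omega>_power_sq_eq:
  assumes "(\<omega> ^ x)\<^sup>2 = (\<omega> ^ y)\<^sup>2" shows "x mod m = y mod m"
proof -
  have "\<omega>\<^sup>2 = cis (2 * pi / m)" by (simp add: \<omega>_def DeMoivre n_def)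
  then have "(\<omega> ^ j)\<^sup>2 = cis (2 * pi / m) ^ j" for j
    by (metis power_mult mult.commute)
  then show ?thesis using cis_root_power_eq[of m x y] m assms by simp
qed

text \<open>The bound \<open>p < 1\<close> amounts to cos (pi / n) > 1 / 2 = cos (pi / 3), which
  holds because \<open>n\<close> exceeds 3.\<close>

lemma p_bounds: "0 < p" "p < 1"
proof -
  have "cos (pi / 3) < cos (pi / n)"
    using n_ge by (intro cos_monotone_0_pi) (auto simp: field_simps)
  then have "cos (pi / n) > 1 / 2" by (simp add: cos_60)
  then show "0 < p" "p < 1" by (simp_all add: p_def field_simps)
qed

text \<open>Since \<open>\<omega>\<close> is the square of \<open>\<zeta>\<close>, 1 +
  \<open>\<omega>\<close> is \<open>\<zeta>\<close> times twice its real part, and \<open>p\<close>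
  is the inverse of that factor.\<close>

lemma p_\<zeta>: "of_real p + of_real p * \<omega> = \<zeta>"
proof -
  have cz: "\<zeta> + cnj \<zeta> = of_real (2 * cos (pi / n))"
    by (simp add: \<zeta>_def complex_eq_iff)
  have "of_real p + of_real p * \<omega> = of_real p * (\<zeta> * cnj \<zeta> + \<zeta> * \<zeta>)"
    by (simp add: unimodular \<omega>_eq power2_eq_square algebra_simps)
  also have "\<dots> = \<zeta> * of_real (p * (2 * cos (pi / n)))"
    using cz by (simp add: algebra_simps flip: distrib_left)
  also have "p * (2 * cos (pi / n)) = 1" using p_bounds by (simp add: p_def)
  finally show ?thesis by simp
qed

text \<open>As \<open>n\<close> is even, frequency \<open>n - 1\<close> is odd like frequency 1, so
  the two values of \<open>z\<close> have the same coefficients and are conjugate.\<close>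

lemma z_kernel: "z 0 = 1" "z 1 = \<zeta>" "z (n - 1) = cnj \<zeta>"
proof -
  show "z 0 = 1" by (simp add: z_def c_def)
  show "z 1 = \<zeta>" using p_\<zeta> by (simp add: z_def c_def)
  have "\<omega> * \<omega> ^ (n - 1) = \<omega> * cnj \<omega>"
    using \<omega>_power_n n_ge unimodular by (simp flip: power_Suc)
  then have "\<omega> ^ (n - 1) = cnj \<omega>" using roots_nonzero(1)[of 1] by simp
  moreover have "odd (n - 1)" using even_n n_ge by simp
  ultimately show "z (n - 1) = cnj \<zeta>"
    using arg_cong[OF p_\<zeta>, of cnj] by (simp add: z_def c_def)
qed

lemma norm_\<zeta>: "cmod \<zeta> = 1"
  by (simp add: \<zeta>_def)

lemma s_kernel: "s 0 = 0" "s 1 = 0" "s (n - 1) = 0"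
  unfolding s_def z_kernel by (simp_all add: norm_\<zeta>)

lemma norm_z: "(cmod (z f))\<^sup>2 = p\<^sup>2 + (c f)\<^sup>2 + 2 * p * c f * cos (2 * pi * f / n)"
proof -
  let ?t = "2 * pi * f / n"
  have "\<omega> ^ f = cis ?t" by (simp add: \<omega>_def DeMoivre mult_ac)
  then have "(cmod (z f))\<^sup>2 = (p + c f * cos ?t)\<^sup>2 + (c f * sin ?t)\<^sup>2"
    by (simp add: z_def cmod_power2)
  also have "\<dots> = p\<^sup>2 + (c f)\<^sup>2 * ((sin ?t)\<^sup>2 + (cos ?t)\<^sup>2) + 2 * p * c f * cos ?t"
    by (simp only: power2_sum power_mult_distrib distrib_left)
  finally show ?thesis by simp
qed

text \<open>With t the angle of frequency \<open>f\<close>, the squared modulus is 1 - 2 p (1 - p)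
  (1 - cos t) for even \<open>f\<close> and 2 p^2 (1 + cos t) for odd \<open>f\<close>. The latter
  equals 1 at \<open>f = 1\<close>, and the frequencies considered are farther from 0 modulo
  \<open>n\<close>, hence have a smaller cosine.\<close>

lemma norm_z_less_1:
  assumes "2 \<le> f" "f \<le> n - 2"
  shows "(cmod (z f))\<^sup>2 < 1"
proof -
  let ?a = "2 * pi / n"
  let ?t = "2 * pi * f / n"
  have f: "real f \<ge> 2" "real f \<le> real n - 2" using assms n_ge by auto
  have lt: "cos ?t < cos ?a"
  proof (cases "?t \<le> pi")
    case True
    then show ?thesis using f n_ge by (intro cos_monotone_0_pi) (auto simp: divide_simps)
  next
    case False
    \<comment> \<open>Beyond pi the angle is reflected to 2 * pi - t, which still exceeds
      \<open>?a\<close> because f + 1 < n.\<close>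
    have "2 * pi * ((real f + 1) / n) < 2 * pi * 1"
      using f n_ge by (intro mult_strict_left_mono) auto
    then have "?a < 2 * pi - ?t" by (simp add: add_divide_distrib distrib_left)
    then have "cos (2 * pi - ?t) < cos ?a"
      using False by (intro cos_monotone_0_pi) auto
    then show ?thesis by simp
  qed
  show ?thesis
  proof (cases "even f")
    case True
    have "cos ?t < 1" using lt cos_le_one[of ?a] by linarith
    then have "2 * p * (1 - p) * cos ?t < 2 * p * (1 - p) * 1"
      using p_bounds by (intro mult_strict_left_mono) auto
    then show ?thesis using True unfolding norm_z c_def
      by (simp add: power2_eq_square algebra_simps)
  next
    case False
    have "2 * p\<^sup>2 * (1 + cos ?t) < 2 * p\<^sup>2 * (1 + cos ?a)"
      using lt p_bounds by (intro mult_strict_left_mono) auto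
    also have "cos ?a = 2 * (cos (pi / n))\<^sup>2 - 1"
      using cos_double_cos[of "pi / n"] by simp
    also have "2 * p\<^sup>2 * (1 + (2 * (cos (pi / n))\<^sup>2 - 1)) = (p * (2 * cos (pi / n)))\<^sup>2"
      by (simp add: power2_eq_square algebra_simps)
    also have "p * (2 * cos (pi / n)) = 1" using p_bounds by (simp add: p_def)
    finally show ?thesis using False unfolding norm_z c_def
      by (simp add: power2_eq_square algebra_simps)
  qed
qed

lemma s_nonzero: "\<lbrakk>2 \<le> f; f \<le> n - 2\<rbrakk> \<Longrightarrow> s f \<noteq> 0"
  using norm_z_less_1[of f] by (simp add: s_def)

lemma kernel_cases: "f < n \<Longrightarrow> f \<in> {0, 1, n - 1} \<or> f \<in> {2..<n - 1}"
  by auto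

text \<open>The extra coordinate \<open>s f\<close> completes \<open>z f\<close> to a unit vector;
  the modulus bound makes the radicand nonnegative.\<close>

lemma z_s_norm: "f < n \<Longrightarrow> z f * cnj (z f) + s f * cnj (s f) = 1"
proof -
  assume f: "f < n"
  have "(cmod (z f))\<^sup>2 \<le> 1"
  proof (cases "f \<in> {2..<n - 1}")
    case True
    then have "2 \<le> f" "f \<le> n - 2" by auto
    then show ?thesis using norm_z_less_1 by (simp add: less_imp_le)
  next
    case False
    then have "f = 0 \<or> f = 1 \<or> f = n - 1" using kernel_cases[OF f] by blast
    then show ?thesis using z_kernel norm_\<zeta> by (metis complex_mod_cnj norm_one one_power2 order_refl)
  qed
  then have "s f * cnj (s f) = of_real (1 - (cmod (z f))\<^sup>2)"
    by (simp add: s_def flip: of_real_mult)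
  then show ?thesis by (simp add: complex_norm_square[symmetric] del: of_real_power)
qed

section \<open>Inner products within the Fourier family\<close>

lemma sum_split:
  fixes g :: "nat \<Rightarrow> complex"
  shows "(\<Sum>i<2 * n - 3. g i) = (\<Sum>f<n. g f) + (\<Sum>f\<in>{2..<n - 1}. g (n + f - 2))"
proof -
  have set: "{..<2 * n - 3} = {..<n} \<union> {n..<2 * n - 3}" using n_ge by auto
  have "(\<Sum>i<2 * n - 3. g i) = (\<Sum>f<n. g f) + (\<Sum>i\<in>{n..<2 * n - 3}. g i)"
    unfolding set by (rule sum.union_disjoint) auto
  also have "(\<Sum>i\<in>{n..<2 * n - 3}. g i) = (\<Sum>f\<in>{2..<n - 1}. g (n + f - 2))"
    by (rule sum.reindex_bij_witness[of _ "\<lambda>f. n + f - 2" "\<lambda>i. i - n + 2"]) (use n_ge in auto)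
  finally show ?thesis .
qed

lemma sum_kernel_neutral:
  fixes g :: "nat \<Rightarrow> complex"
  assumes "\<And>f. f \<in> {0, 1, n - 1} \<Longrightarrow> g f = 0"
  shows "(\<Sum>f\<in>{2..<n - 1}. g f) = (\<Sum>f<n. g f)"
proof (intro sum.mono_neutral_left ballI)
  fix f assume "f \<in> {..<n} - {2..<n - 1}"
  then have "f \<in> {0, 1, n - 1}" using kernel_cases[of f] by blast
  then show "g f = 0" by (rule assms)
qed auto

lemma w_high: "f \<in> {2..<n - 1} \<Longrightarrow> w (x, True) (n + f - 2) = (\<omega> ^ x) ^ f * s f"
proof -
  assume "f \<in> {2..<n - 1}"
  then have "\<not> n + f - 2 < n" "n + f - 2 - n + 2 = f" by auto
  then show ?thesis by (simp only: w_def Let_def fst_conv snd_conv if_False if_True)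
qed

text \<open>For a fixed bit, the inner products with the \<open>w (x, e)\<close> are the discrete
  Fourier transform in \<open>x\<close> of one sequence, so they can be inverted.\<close>

lemma cin_w:
  "cin (2 * n - 3) \<phi> (w (x, e)) =
     (\<Sum>f<n. (if e then \<phi> f * cnj (z f) + (if f \<in> {2..<n - 1} then \<phi> (n + f - 2) * cnj (s f) else 0)
             else \<phi> f) * cnj ((\<omega> ^ x) ^ f))"
proof (cases e)
  case True
  have "cin (2 * n - 3) \<phi> (w (x, e)) = (\<Sum>f<n. \<phi> f * cnj ((\<omega> ^ x) ^ f * z f))
      + (\<Sum>f\<in>{2..<n - 1}. \<phi> (n + f - 2) * cnj ((\<omega> ^ x) ^ f * s f))"
    unfolding cin_def sum_split using True
    by (intro arg_cong2[of _ _ _ _ "(+)"] sum.cong) (simp_all add: w_high, simp add: w_def)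
  also have "(\<Sum>f\<in>{2..<n - 1}. \<phi> (n + f - 2) * cnj ((\<omega> ^ x) ^ f * s f)) =
     (\<Sum>f\<in>{2..<n - 1}. (if f \<in> {2..<n - 1} then \<phi> (n + f - 2) * cnj (s f) else 0) * cnj ((\<omega> ^ x) ^ f))"
    by (intro sum.cong) auto
  also have "\<dots> = (\<Sum>f<n. (if f \<in> {2..<n - 1} then \<phi> (n + f - 2) * cnj (s f) else 0) * cnj ((\<omega> ^ x) ^ f))"
    by (intro sum_kernel_neutral) auto
  finally show ?thesis using True
    by (simp add: sum.distrib[symmetric] algebra_simps)
next
  case False
  then have "w (x, e) (n + f - 2) = 0" if "f \<in> {2..<n - 1}" for f
    using that by (auto simp: w_def)
  then show ?thesis
    using False unfolding cin_def sum_split by (simp add: w_def[of _ "_ :: nat"])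
qed

lemma sum_characters:
  assumes "x < n" "y < n"
  shows "(\<Sum>f<n. (\<omega> ^ x) ^ f * cnj ((\<omega> ^ y) ^ f)) = (if x = y then of_nat n else 0)"
proof -
  let ?e = "\<omega> ^ x * cnj (\<omega> ^ y)"
  have "(\<Sum>f<n. (\<omega> ^ x) ^ f * cnj ((\<omega> ^ y) ^ f)) = (\<Sum>f<n. ?e ^ f)"
    by (simp add: power_mult_distrib)
  also have "\<dots> = (if x = y then of_nat n else 0)"
  proof (cases "x = y")
    case True
    then show ?thesis by (simp add: unimodular_power)
  next
    case False
    have "?e \<noteq> 1"
    proof
      assume "?e = 1"
      then have "\<omega> ^ x * (\<omega> ^ y * cnj \<omega> ^ y) = \<omega> ^ y" by (simp add: mult.left_commute mult.assoc)
      then show False using \<omega>_power_inj[OF assms] False by (simp add: unimodular_power)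
    qed
    moreover have "?e ^ n = 1"
    proof -
      have "(\<omega> ^ j) ^ n = 1" for j
        using \<omega>_power_n by (metis mult.commute power_mult power_one)
      then show ?thesis by (simp only: power_mult_distrib complex_cnj_power[symmetric]) simp
    qed
    ultimately show ?thesis using False by (simp add: sum_powers_root_unity)
  qed
  finally show ?thesis .
qed


lemma w_nonzero: "nonzero_vec (2 * n - 3) (w v)"
  using n_ge by (intro exI[of _ 0]) (simp add: w_def Let_def z_kernel)

text \<open>The Gram blocks have unit diagonal, so only the orthogonality of distinct characters
  remains.\<close>

lemma w_orthogonal_same:
  assumes "x < n" "y < n" "x \<noteq> y"
  shows "cin (2 * n - 3) (w (x, e)) (w (y, e)) = 0"
proof -
  have "(if e then w (x, e) f * cnj (z f) +
      (if f \<in> {2..<n - 1} then w (x, e) (n + f - 2) * cnj (s f) else 0) else w (x, e) f)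
      = (\<omega> ^ x) ^ f" if f: "f < n" for f
  proof (cases e)
    case True
    have "w (x, e) f * cnj (z f) + (if f \<in> {2..<n - 1} then w (x, e) (n + f - 2) * cnj (s f) else 0)
      = (\<omega> ^ x) ^ f * (z f * cnj (z f) + s f * cnj (s f))"
    proof (cases "f \<in> {2..<n - 1}")
      case in2: True
      then show ?thesis using f True w_high[OF in2] by (simp add: w_def[of _ f] algebra_simps)
    next
      case False
      then have "f = 0 \<or> f = 1 \<or> f = n - 1" using kernel_cases[OF f] by blast
      then have "s f = 0" using s_kernel by metis
      then show ?thesis using f True False by (auto simp: w_def[of _ f])
    qed
    then show ?thesis using True z_s_norm[OF f] by simp
  qed (use f in \<open>simp add: w_def\<close>)
  then have "cin (2 * n - 3) (w (x, e)) (w (y, e)) = (\<Sum>f<n. (\<omega> ^ x) ^ f * cnj ((\<omega> ^ y) ^ f))"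
    unfolding cin_w by (intro sum.cong) auto
  then show ?thesis using sum_characters assms by simp
qed

text \<open>Each of the three characters in \<open>z\<close> contributes a geometric sum over powers
  of an \<open>n\<close>-th root of unity, and the hypotheses make all three roots different from
  1.\<close>

lemma w_orthogonal_mixed:
  assumes "x < n" "y < n" "x \<noteq> y" "x mod m \<noteq> (y + 1) mod m"
  shows "cin (2 * n - 3) (w (x, False)) (w (y, True)) = 0"
proof -
  define e where "e = \<omega> ^ x * cnj (\<omega> ^ y)"
  define e' where "e' = e * cnj \<omega>"
  \<comment> \<open>The alternating sign turns the parity rule into characters, with ratios
    \<open>e'\<close> and \<open>- e'\<close>.\<close>
  have c: "c f = 1 / 2 + (1 / 2 - p) * (-1) ^ f" for f
    by (simp add: c_def)
  have low: "w (x, False) (n + f - 2) = 0" if "f \<in> {2..<n - 1}" for f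
    using that by (auto simp: w_def)
  have "cin (2 * n - 3) (w (x, False)) (w (y, True)) =
      (\<Sum>f<n. (\<omega> ^ x) ^ f * cnj (z f) * cnj ((\<omega> ^ y) ^ f))"
    unfolding cin_w by (intro sum.cong) (auto simp: low w_def[of _ "_ :: nat"])
  also have "\<dots> = (\<Sum>f<n. of_real p * e ^ f + 1 / 2 * e' ^ f + of_real (1 / 2 - p) * (- e') ^ f)"
  proof (intro sum.cong refl)
    fix f
    have "(\<omega> ^ x) ^ f * cnj (z f) * cnj ((\<omega> ^ y) ^ f) = e ^ f * (of_real p + of_real (c f) * cnj \<omega> ^ f)"
      by (simp add: e_def z_def power_mult_distrib mult_ac)
    also have "\<dots> = of_real p * e ^ f + of_real (c f) * e' ^ f"
      by (simp add: e'_def power_mult_distrib algebra_simps)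
    also have "of_real (c f) * e' ^ f = 1 / 2 * e' ^ f + of_real (1 / 2 - p) * (- e') ^ f"
      unfolding c by (subst power_minus) (simp add: algebra_simps)
    finally show "(\<omega> ^ x) ^ f * cnj (z f) * cnj ((\<omega> ^ y) ^ f)
        = of_real p * e ^ f + 1 / 2 * e' ^ f + of_real (1 / 2 - p) * (- e') ^ f"
      by (simp add: add.assoc)
  qed
  also have "\<dots> = of_real p * (\<Sum>f<n. e ^ f) + 1 / 2 * (\<Sum>f<n. e' ^ f)
      + of_real (1 / 2 - p) * (\<Sum>f<n. (- e') ^ f)"
    by (simp only: sum.distrib sum_distrib_left)
  also have "(\<Sum>f<n. e ^ f) = 0"
    using sum_characters[OF assms(1,2)] assms(3) by (simp add: e_def power_mult_distrib)
  finally have "cin (2 * n - 3) (w (x, False)) (w (y, True)) = 1 / 2 * (\<Sum>f<n. e' ^ f)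
      + of_real (1 / 2 - p) * (\<Sum>f<n. (- e') ^ f)" by simp
  moreover have "(\<Sum>f<n. e' ^ f) = 0 \<and> (\<Sum>f<n. (- e') ^ f) = 0"
  proof -
    \<comment> \<open>Both signs are excluded at once by squaring; as \<open>\<omega>\<close> ^ m =
      -1, this is why the condition is modulo \<open>m\<close> and not \<open>n\<close>.\<close>
    have "e'\<^sup>2 \<noteq> 1"
    proof
      assume "e'\<^sup>2 = 1"
      then have "(e' * \<omega> ^ (y + 1))\<^sup>2 = (\<omega> ^ (y + 1))\<^sup>2" by (simp add: power_mult_distrib)
      moreover have "e' * \<omega> ^ (y + 1) = \<omega> ^ x * (\<omega> ^ y * cnj \<omega> ^ y) * (\<omega> * cnj \<omega>)"
        by (simp add: e'_def e_def mult_ac)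
      ultimately show False
        using \<omega>_power_sq_eq[of x "y + 1"] assms(4) by (simp add: unimodular unimodular_power)
    qed
    then have "e' \<noteq> 1" "- e' \<noteq> 1" by (metis one_power2, metis one_power2 power2_minus)
    moreover have "e' ^ n = 1"
    proof -
      have "(\<omega> ^ j) ^ n = 1" for j
        using \<omega>_power_n by (metis mult.commute power_mult power_one)
      moreover have "e' = \<omega> ^ x * cnj (\<omega> ^ (y + 1))" by (simp add: e'_def e_def)
      ultimately show ?thesis by (simp only: power_mult_distrib complex_cnj_power[symmetric]) simp
    qed
    moreover from this have "(- e') ^ n = 1" using even_n by simp
    ultimately show ?thesis using sum_powers_root_unity by blast
  qed
  ultimately show ?thesis by simp
qed

section \<open>Fourier inversion and the spanning property\<close>

lemma fourier_inversion:
  assumes "f < n"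
  shows "(\<Sum>x<n. (\<Sum>h<n. g h * cnj ((\<omega> ^ x) ^ h)) * (\<omega> ^ x) ^ f) = of_nat n * g f"
proof -
  have "(\<Sum>x<n. (\<Sum>h<n. g h * cnj ((\<omega> ^ x) ^ h)) * (\<omega> ^ x) ^ f)
      = (\<Sum>h<n. \<Sum>x<n. g h * ((\<omega> ^ f) ^ x * cnj ((\<omega> ^ h) ^ x)))"
    by (subst sum.swap, simp add: sum_distrib_right sum_distrib_left)
      (intro sum.cong refl, simp add: mult_ac flip: power_mult)
  also have "\<dots> = (\<Sum>h<n. g h * (if f = h then of_nat n else 0))"
    using assms by (intro sum.cong refl) (subst sum_distrib_left[symmetric], subst sum_characters, auto)
  also have "\<dots> = of_nat n * g f"
    using assms by (simp add: if_distrib sum.delta' mult.commute cong: if_cong)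
  finally show ?thesis .
qed

text \<open>The vectors \<open>w v\<close> satisfy exactly three independent linear relations, coming from
  the frequencies 0, 1 and n - 1, where the Gram block is singular. Their coefficients at v are
  \<open>1\<close>, \<open>l v\<close> and \<open>inverse (l v)\<close> up to a common sign, for pairwise distinct roots of unity \<open>l v\<close>.\<close>

lemma w_spanning:
  assumes T: "T \<subseteq> V" "card T \<le> 3"
    and orth: "\<And>v. v \<in> V - T \<Longrightarrow> cin (2 * n - 3) \<phi> (w v) = 0"
  shows "\<not> nonzero_vec (2 * n - 3) \<phi>"
proof -
  define g where "g e f = (if e then \<phi> f * cnj (z f)
      + (if f \<in> {2..<n - 1} then \<phi> (n + f - 2) * cnj (s f) else 0) else \<phi> f)" for e f
  define \<gamma> where "\<gamma> v = cin (2 * n - 3) \<phi> (w v)" for v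
  \<comment> \<open>Read off from \<open>rel\<close> at frequencies 0, 1 and \<open>n - 1\<close>,
    where the conjugate of \<open>z\<close> is 1, \<open>cnj \<zeta>\<close> and
    \<open>\<zeta>\<close>. The sign \<open>\<sigma>\<close> moves the right-hand side to the
    left.\<close>
  define l where "l v = \<omega> ^ fst v * (if snd v then 1 else cnj \<zeta>)" for v :: "nat \<times> bool"
  define \<sigma> where "\<sigma> v = (if snd v then 1 else - 1 :: complex)" for v :: "nat \<times> bool"
  have inv: "(\<Sum>x<n. \<gamma> (x, e) * (\<omega> ^ x) ^ f) = of_nat n * g e f" if "f < n" for e f
    unfolding \<gamma>_def cin_w using fourier_inversion[OF that, of "g e"] by (simp add: g_def)
  \<comment> \<open>At these frequencies there is no extra coordinate, so both transforms depend on
    \<open>\<phi> f\<close> alone.\<close>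
  have rel: "(\<Sum>x<n. \<gamma> (x, True) * (\<omega> ^ x) ^ f) = cnj (z f) * (\<Sum>x<n. \<gamma> (x, False) * (\<omega> ^ x) ^ f)"
    if "f < n" "f \<notin> {2..<n - 1}" for f
    using that by (simp add: inv g_def del: atLeastLessThan_iff)
  have sumV: "(\<Sum>v\<in>V. h v) = (\<Sum>x<n. h (x, True)) + (\<Sum>x<n. h (x, False))" for h :: "_ \<Rightarrow> complex"
  proof -
    have "(\<Sum>v\<in>V. h v) = (\<Sum>x<n. \<Sum>e\<in>UNIV. h (x, e))"
      by (simp only: V_def sum.cartesian_product split_def prod.collapse)
    then show ?thesis by (simp add: UNIV_bool sum.distrib add.commute)
  qed
  have inv\<zeta>: "inverse (cnj \<zeta>) = \<zeta>" using unimodular by (metis inverse_unique mult.commute)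
  have l0: "l v \<noteq> 0" for v
    using roots_nonzero by (simp add: l_def)
  have injl: "inj_on l V"
  proof (rule inj_onI)
    fix v v' assume v: "v \<in> V" "v' \<in> V" "l v = l v'"
    \<comment> \<open>The \<open>n\<close>-th power of \<open>l v\<close> is 1 or -1 according to
      the bit.\<close>
    have "snd v = snd v'"
    proof -
      have "(\<omega> ^ j) ^ n = 1" for j
        using \<omega>_power_n by (metis mult.commute power_mult power_one)
      moreover have "cnj \<zeta> ^ n = -1" using arg_cong[OF \<zeta>_power_n, of cnj] by simp
      ultimately have "l u ^ n = (if snd u then 1 else -1)" for u
        by (simp add: l_def power_mult_distrib)
      then show ?thesis using v(3) by (metis one_neq_neg_one)
    qed
    moreover from this have "\<omega> ^ fst v = \<omega> ^ fst v'" using v(3) roots_nonzero(2) by (auto simp: l_def split: if_splits)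
    ultimately show "v = v'" using v \<omega>_power_inj by (auto simp: V_def prod_eq_iff)
  qed
  have \<omega>1: "(\<omega> ^ x) ^ (n - 1) = inverse (\<omega> ^ x)" for x
  proof -
    have "\<omega> ^ x * (\<omega> ^ x) ^ (n - 1) = (\<omega> ^ x) ^ n"
      using n_ge by (simp flip: power_Suc)
    also have "\<dots> = 1" using \<omega>_power_n by (metis mult.commute power_mult power_one)
    finally show ?thesis by (metis inverse_unique)
  qed
  have "(\<Sum>v\<in>V. \<sigma> v * \<gamma> v) = 0"
    using rel[of 0] n_ge by (simp add: sumV \<sigma>_def z_kernel sum_negf)
  moreover have "(\<Sum>v\<in>V. \<sigma> v * \<gamma> v * l v) = 0"
    using rel[of 1] n_ge z_kernel(2)
    by (simp add: sumV \<sigma>_def l_def sum_negf sum_distrib_left mult_ac)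
  moreover have "(\<Sum>v\<in>V. \<sigma> v * \<gamma> v * inverse (l v)) = 0"
    using rel[of "n - 1"] n_ge
    unfolding z_kernel(3) \<omega>1
    by (simp add: sumV \<sigma>_def l_def sum_negf sum_distrib_left mult_ac inv\<zeta>)
  moreover have "finite V" by (simp add: V_def)
  moreover have "\<sigma> v * \<gamma> v = 0" if "v \<in> V - T" for v
    using orth[OF that] by (simp add: \<gamma>_def)
  ultimately have "\<sigma> v * \<gamma> v = 0" if "v \<in> V" for v
    using vandermonde3[of V T l "\<lambda>v. \<sigma> v * \<gamma> v" v, OF _ T injl] l0 that by blast
  then have \<gamma>0: "\<gamma> (x, e) = 0" if "x < n" for x e
  proof -
    have "\<sigma> (x, e) * \<gamma> (x, e) = 0"
      using \<open>\<And>v. v \<in> V \<Longrightarrow> \<sigma> v * \<gamma> v = 0\<close>[of "(x, e)"] that by (simp add: V_def)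
    then show ?thesis by (simp add: \<sigma>_def split: if_splits)
  qed
  have g0: "g e f = 0" if "f < n" for e f
    using inv[OF that, of e] \<gamma>0 n_ge by simp
  have low: "\<phi> f = 0" if "f < n" for f
    using g0[OF that, of False] by (simp add: g_def)
  \<comment> \<open>Once \<open>\<phi> f\<close> vanishes, the transform for the bit
    \<open>True\<close> leaves the extra coordinate times the nonzero
    \<open>cnj (s f)\<close>.\<close>
  have high: "\<phi> (n + f - 2) = 0" if "f \<in> {2..<n - 1}" for f
  proof -
    have "f < n" "2 \<le> f" "f \<le> n - 2" using that by auto
    then show ?thesis using g0[of f True] low[of f] s_nonzero[of f] that by (simp add: g_def)
  qed
  have "\<phi> i = 0" if "i < 2 * n - 3" for i
  proof (cases "i < n")
    case False
    then have "i - n + 2 \<in> {2..<n - 1}" "n + (i - n + 2) - 2 = i" using that by auto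
    then show ?thesis using high[of "i - n + 2"] by (simp only:)
  qed (rule low)
  then show ?thesis by blast
qed

section \<open>Assembling the three factors\<close>

lemma UPB_exists: "\<exists>S. finite S \<and> is_UPB [2, 2, 2 * n - 3] S \<and> card S = 2 * n"
proof -
  \<comment> \<open>The shift for the bit \<open>True\<close> lets (x, False) and (y, True) share a
    basis exactly if x = y + 1 modulo \<open>m\<close>. In \<open>b\<close> they share one exactly
    if x = y. These are the exceptions left open by the third factor.\<close>
  define a where "a v = planar (1 + (if snd v then fst v + 1 else fst v) mod m) (snd v)"
    for v :: "nat \<times> bool"
  define b where "b v = planar (1 + fst v) (snd v)" for v :: "nat \<times> bool"
  have orth_aux: "cin 2 (a (x, False)) (a (y, True)) = 0 \<or> cin 2 (b (x, False)) (b (y, True)) = 0 \<or>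
      cin (2 * n - 3) (w (x, False)) (w (y, True)) = 0" if "x < n" "y < n" for x y
  proof -
    consider "x = y" | "x mod m = (y + 1) mod m" | "x \<noteq> y" "x mod m \<noteq> (y + 1) mod m" by blast
    then show ?thesis
    proof cases
      case 1
      then have "cin 2 (b (x, False)) (b (y, True)) = 0"
        unfolding b_def by (simp add: planar_orthogonal)
      then show ?thesis by blast
    next
      case 2
      then have "cin 2 (a (x, False)) (a (y, True)) = 0"
        unfolding a_def by (simp add: planar_orthogonal)
      then show ?thesis by blast
    qed (use w_orthogonal_mixed[OF that] in blast)
  qed
  have "\<exists>S. finite S \<and> is_UPB [2, 2, 2 * n - 3] S \<and> card S = card V"
  proof (rule UPB_of_family[where u = a and v = b and w = w])
    show "finite V" by (simp add: V_def)
    fix v assume "v \<in> V"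
    show "nonzero_vec 2 (a v) \<and> nonzero_vec 2 (b v) \<and> nonzero_vec (2 * n - 3) (w v)"
      unfolding a_def b_def using planar_nonzero w_nonzero by blast
  next
    fix v v' assume vv': "v \<in> V" "v' \<in> V" "v \<noteq> v'"
    obtain x e y e' where v: "v = (x, e)" "v' = (y, e')" by fastforce
    have xy: "x < n" "y < n" using vv' v by (auto simp: V_def)
    show "cin 2 (a v) (a v') = 0 \<or> cin 2 (b v) (b v') = 0 \<or> cin (2 * n - 3) (w v) (w v') = 0"
    proof (cases "e = e'")
      case True
      then show ?thesis using w_orthogonal_same[OF xy] vv' v by auto
    next
      case False
      then show ?thesis
        using orth_aux[OF xy] orth_aux[OF xy(2,1)] cin_eq_0_commute v by (cases e; cases e') auto
    qed
  next
    fix \<alpha> \<beta> \<phi> assume nz: "nonzero_vec 2 \<alpha>" "nonzero_vec 2 \<beta>" "nonzero_vec (2 * n - 3) \<phi>"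
    define A where "A = {v \<in> V. cin 2 \<alpha> (a v) = 0}"
    define B where "B = {v \<in> V. cin 2 \<beta> (b v) = 0}"
    have fin: "finite A" "finite B" by (simp_all add: A_def B_def V_def)
    have cardA: "card A \<le> 2"
    proof (cases "A = {}")
      case False
      then obtain x e where x: "(x, e) \<in> A" by auto
      \<comment> \<open>A residue modulo \<open>m\<close> has two representatives below
        \<open>n = 2 * m\<close>.\<close>
      have "A \<subseteq> {(x mod m, e), (x mod m + m, e)}"
      proof
        fix v assume v: "v \<in> A"
        obtain y e' where v': "v = (y, e')" by fastforce
        have y: "y < 2 * m" using v v' by (auto simp: A_def V_def n_def)
        have "1 + (if e' then y + 1 else y) mod m = 1 + (if e then x + 1 else x) mod m \<and> e' = e"
        proof (rule planar_eqI[OF nz(1)])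
          show "cin 2 \<alpha> (planar (1 + (if e' then y + 1 else y) mod m) e') = 0"
            using v v' by (auto simp: A_def a_def split: if_splits)
          show "cin 2 \<alpha> (planar (1 + (if e then x + 1 else x) mod m) e) = 0"
            using x by (auto simp: A_def a_def split: if_splits)
        qed
        then have e: "e' = e" and "y mod m = x mod m"
          by (auto split: if_splits simp: mod_Suc)
        moreover have "y = y mod m \<or> y = y mod m + m"
          using y by (cases "y < m") (auto simp: mod_if)
        ultimately show "v \<in> {(x mod m, e), (x mod m + m, e)}" using v' by auto
      qed
      then have "card A \<le> card {(x mod m, e), (x mod m + m, e)}" by (intro card_mono) auto
      also have "\<dots> \<le> 2" by (simp add: card_insert_if)
      finally show ?thesis .
    qed simp
    have "v = v'" if "v \<in> B" "v' \<in> B" for v v'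
    proof -
      have "1 + fst v = 1 + fst v' \<and> snd v = snd v'"
        using that by (intro planar_eqI[OF nz(2)]) (auto simp: B_def b_def)
      then show ?thesis by (simp add: prod_eq_iff)
    qed
    then have "card B \<le> 1" using fin by (simp add: card_le_Suc0_iff_eq)
    then have "card (A \<union> B) \<le> 3" using cardA card_Un_le[of A B] by linarith
    moreover have "A \<union> B \<subseteq> V" by (auto simp: A_def B_def)
    ultimately obtain v where "v \<in> V - (A \<union> B)" "cin (2 * n - 3) \<phi> (w v) \<noteq> 0"
      using w_spanning[of "A \<union> B" \<phi>] nz(3) by blast
    then show "\<exists>v\<in>V. cin 2 \<alpha> (a v) \<noteq> 0 \<and> cin 2 \<beta> (b v) \<noteq> 0 \<and> cin (2 * n - 3) \<phi> (w v) \<noteq> 0"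
      by (intro bexI[of _ v]) (auto simp: A_def B_def)
  qed
  then show ?thesis by (simp add: V_def card_cartesian_product mult.commute)
qed

end

theorem theorem2:
  fixes k :: nat
  assumes "k > 0"
  shows "f_m [2, 2, 4*k+1] = f_N [2, 2, 4*k+1] + 1 \<and> f_N [2, 2, 4*k+1] + 1 = 4*k+4"
proof -
  \<comment> \<open>With m = k + 1 the third dimension 2n - 3 becomes 4k + 1, and k > 0 gives m at
    least 2.\<close>
  interpret fourier_family "Suc k"
    using assms by unfold_locales simp
  have n: "2 * n - 3 = 4 * k + 1" "2 * n = 4 * k + 4" by (simp_all add: n_def)
  have "f_m [2, 2, 4*k+1] = 4*k+4"
    unfolding f_m_def
  proof (rule Least_equality)
    show "\<exists>S. finite S \<and> is_UPB [2, 2, 4*k+1] S \<and> card S = 4*k+4"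
      using UPB_exists unfolding n by simp
  next
    fix j assume "\<exists>S. finite S \<and> is_UPB [2, 2, 4*k+1] S \<and> card S = j"
    then obtain S where S: "finite S" "is_UPB [2, 2, 4*k+1] S" "card S = j" by blast
    show "4*k+4 \<le> j"
    proof (rule ccontr)
      assume "\<not> 4*k+4 \<le> j"
      then have "card S \<le> (4*k+1) + 2" using S(3) by simp
      then have "card S = (4*k+1) + 2 \<and> even (card S)"
        by (intro UPB_card_lower[OF S(1,2)]) simp_all
      \<comment> \<open>A smaller basis would have exactly 4k + 3 members, an odd number.\<close>
      then have "even ((4*k+1) + 2)" by metis
      then show False by simp
    qed
  qed
  then show ?thesis by (simp add: f_N_def)
qed

end
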